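(* Let $q\ge 2$ and $n\ge 1$ be integers, and let $D=\{d_1,\ldots,d_k\}\subseteq\{1,\ldots,n\}$ with $1\le d_1<\cdots<d_k\le n$. Let $G(\mathbb{Z}_q^n,D)$ be the distance graph of $(\mathbb{Z}_q^n,\rho)$ with distance set $D$, where $\rho$ is the RT metric. Define graphs recursively by $H_1=K_q(q^{d_1-1})$ and $H_j=\left[q^{\,d_j-d_{j-1}-1}H_{j-1}\right]^q$ for $j=2,\ldots,k$. Then $$G(\mathbb{Z}_q^n,D)\cong q^{\,n-d_k}H_k,$$ i.e. $G(\mathbb{Z}_q^n,D)\cong q^{n-d_k}\left[q^{d_k-d_{k-1}-1}\left[\cdots\left[q^{d_2-d_1-1}K_q(q^{d_1-1})\right]^q\cdots\right]^q\right]^q$.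
   Context: $\mathbb{Z}_q=\{0,1,\ldots,q-1\}$ (integers mod $q$). For $x=(x_1,\ldots,x_n)\in\mathbb{Z}_q^n$, the RT weight is $\omega(x)=\max\{i: x_i\neq 0\}$ if $x\ne 0$ and $\omega(0)=0$; the RT (Rosenbloom–Tsfasman) distance is $\rho(x,y)=\omega(x-y)$. For a metric space $(X,d)$ and a set $D$ of positive reals, the distance graph $G(X,D)$ has vertex set $X$ and an edge $xy$ for distinct $x,y\in X$ whenever $d(x,y)\in D$. For a graph $G$ and positive integer $m$, $mG$ denotes the disjoint union of $m$ copies of $G$, and $[G]^m$ denotes the join $G+\cdots+G$ of $m$ copies of $G$ (disjoint union of the copies together with all edges between vertices of different copies). $K_r(m)$ denotes the complete $r$-partite graph with every part of size $m$. *)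

theory Defs
  imports "HOL-Analysis.Analysis"
begin

record 'a ugraph =
  verts :: "'a set"
  edges :: "'a set set"

definition simple_graph :: "'a ugraph \<Rightarrow> bool" where
  "simple_graph G \<longleftrightarrow> (\<forall>e\<in>edges G. e \<subseteq> verts G \<and> card e = 2)"

definition graph_iso :: "'a ugraph \<Rightarrow> 'b ugraph \<Rightarrow> bool" (infix "\<simeq>\<^sub>G" 50) where
  "G \<simeq>\<^sub>G H \<longleftrightarrow> (\<exists>f. bij_betw f (verts G) (verts H) \<and>
     (\<forall>u\<in>verts G. \<forall>v\<in>verts G. {u, v} \<in> edges G \<longleftrightarrow> {f u, f v} \<in> edges H))"

definition distance_graph :: "'a set \<Rightarrow> ('a \<Rightarrow> 'a \<Rightarrow> real) \<Rightarrow> real set \<Rightarrow> 'a ugraph" where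
  "distance_graph X d D =
     \<lparr>verts = X, edges = {{x, y} | x y. x \<in> X \<and> y \<in> X \<and> x \<noteq> y \<and> d x y \<in> D}\<rparr>"

text \<open>
  The graph operations below are iterated a variable number of times, so all graphs built from
  them share the vertex type \<^typ>\<open>nat list\<close>: vertex \<open>v\<close> of the \<open>i\<close>-th copy of \<open>G\<close> is \<open>i # v\<close>.
\<close>

definition copies :: "nat \<Rightarrow> nat list ugraph \<Rightarrow> nat list ugraph" where
  "copies m G =
     \<lparr>verts = {i # v | i v. i < m \<and> v \<in> verts G},
      edges = {{i # u, i # v} | i u v. i < m \<and> {u, v} \<in> edges G}\<rparr>"

definition join_copies :: "nat \<Rightarrow> nat list ugraph \<Rightarrow> nat list ugraph" where
  "join_copies m G =
     \<lparr>verts = verts (copies m G),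
      edges = edges (copies m G) \<union>
        {{i # u, j # v} | i j u v. i < m \<and> j < m \<and> i \<noteq> j \<and> u \<in> verts G \<and> v \<in> verts G}\<rparr>"

text \<open>The complete \<open>r\<close>-partite graph \<open>K\<^sub>r(m)\<close>; \<open>[i, a]\<close> is the \<open>a\<close>-th vertex of the \<open>i\<close>-th part.\<close>

definition complete_multipartite :: "nat \<Rightarrow> nat \<Rightarrow> nat list ugraph" where
  "complete_multipartite r m =
     \<lparr>verts = {[i, a] | i a. i < r \<and> a < m},
      edges = {{[i, a], [j, b]} | i j a b. i < r \<and> j < r \<and> i \<noteq> j \<and> a < m \<and> b < m}\<rparr>"

text \<open>\<open>\<int>\<^sub>q\<^sup>n\<close>, with coordinates indexed by \<open>1, \<dots>, n\<close> and residues represented by \<open>0, \<dots>, q - 1\<close>.\<close>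

definition Zqn :: "nat \<Rightarrow> nat \<Rightarrow> (nat \<Rightarrow> int) set" where
  "Zqn q n = {1..n} \<rightarrow>\<^sub>E {0..<int q}"

definition Zqn_diff :: "nat \<Rightarrow> nat \<Rightarrow> (nat \<Rightarrow> int) \<Rightarrow> (nat \<Rightarrow> int) \<Rightarrow> nat \<Rightarrow> int" where
  "Zqn_diff q n x y = (\<lambda>i\<in>{1..n}. (x i - y i) mod int q)"

definition rt_weight :: "nat \<Rightarrow> (nat \<Rightarrow> int) \<Rightarrow> nat" where
  "rt_weight n x = (if \<forall>i\<in>{1..n}. x i = 0 then 0 else Max {i\<in>{1..n}. x i \<noteq> 0})"

definition rt_dist :: "nat \<Rightarrow> nat \<Rightarrow> (nat \<Rightarrow> int) \<Rightarrow> (nat \<Rightarrow> int) \<Rightarrow> nat" where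
  "rt_dist q n x y = rt_weight n (Zqn_diff q n x y)"

text \<open>The sequence is indexed from 1, and \<open>H_graph q d 0\<close> is left unspecified.\<close>

fun H_graph :: "nat \<Rightarrow> (nat \<Rightarrow> nat) \<Rightarrow> nat \<Rightarrow> nat list ugraph" where
  "H_graph q d (Suc 0) = complete_multipartite q (q ^ (d 1 - 1))"
| "H_graph q d (Suc (Suc j)) =
     join_copies q (copies (q ^ (d (Suc (Suc j)) - d (Suc j) - 1)) (H_graph q d (Suc j)))"


lemma simple_graph_distance_graph: "simple_graph (distance_graph X d D)"
  by (auto simp: simple_graph_def distance_graph_def)

lemma simple_graph_complete_multipartite: "simple_graph (complete_multipartite r m)"
  by (auto simp: simple_graph_def complete_multipartite_def card_2_iff)

lemma simple_graph_copies: "simple_graph G \<Longrightarrow> simple_graph (copies m G)"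
  by (fastforce simp: simple_graph_def copies_def card_2_iff doubleton_eq_iff)

lemma simple_graph_join_copies:
  assumes "simple_graph G" shows "simple_graph (join_copies m G)"
proof -
  have "e \<subseteq> verts (join_copies m G) \<and> card e = 2" if "e \<in> edges (join_copies m G)" for e
  proof (cases "e \<in> edges (copies m G)")
    case True
    then show ?thesis
      using simple_graph_copies[OF assms, of m] by (simp add: simple_graph_def join_copies_def)
  next
    case False
    with that show ?thesis by (auto simp: join_copies_def copies_def)
  qed
  then show ?thesis by (simp add: simple_graph_def)
qed

lemma simple_graph_H_graph: "1 \<le> j \<Longrightarrow> simple_graph (H_graph q d j)"
  by (induction q d j rule: H_graph.induct)
     (simp_all add: simple_graph_complete_multipartite simple_graph_copies simple_graph_join_copies)

lemma rt_weight_le_iff: "rt_weight n x \<le> m \<longleftrightarrow> (\<forall>i\<in>{1..n}. m < i \<longrightarrow> x i = 0)"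
proof (cases "\<forall>i\<in>{1..n}. x i = 0")
  case False
  then have "{i\<in>{1..n}. x i \<noteq> 0} \<noteq> {}" by blast
  then have "Max {i\<in>{1..n}. x i \<noteq> 0} \<le> m \<longleftrightarrow> (\<forall>i\<in>{i\<in>{1..n}. x i \<noteq> 0}. i \<le> m)"
    by (intro Max_le_iff) simp_all
  moreover have "rt_weight n x = Max {i\<in>{1..n}. x i \<noteq> 0}"
    using False unfolding rt_weight_def by (rule if_not_P)
  moreover have "(\<forall>i\<in>{i\<in>{1..n}. x i \<noteq> 0}. i \<le> m) \<longleftrightarrow> (\<forall>i\<in>{1..n}. m < i \<longrightarrow> x i = 0)"
    using not_le by blast
  ultimately show ?thesis by simp
qed (simp add: rt_weight_def)

lemma Zqn_diff_eq_0_iff: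
  assumes "x \<in> Zqn q n" "y \<in> Zqn q n" "i \<in> {1..n}"
  shows "Zqn_diff q n x y i = 0 \<longleftrightarrow> x i = y i"
proof -
  have "0 \<le> x i" "x i < int q" "0 \<le> y i" "y i < int q"
    using assms by (force simp: Zqn_def PiE_iff)+
  moreover have "Zqn_diff q n x y i = 0 \<longleftrightarrow> x i mod int q = y i mod int q"
    using assms(3) by (simp add: Zqn_diff_def mod_eq_dvd_iff dvd_eq_mod_eq_0)
  ultimately show ?thesis by simp
qed

lemma rt_dist_le_iff:
  assumes "x \<in> Zqn q n" "y \<in> Zqn q n"
  shows "rt_dist q n x y \<le> m \<longleftrightarrow> (\<forall>i\<in>{1..n}. m < i \<longrightarrow> x i = y i)"
  using assms by (simp add: rt_dist_def rt_weight_le_iff Zqn_diff_eq_0_iff)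

lemma Metric_space_rt_dist: "Metric_space (Zqn q n) (\<lambda>x y. real (rt_dist q n x y))"
proof
  show "real (rt_dist q n x y) = real (rt_dist q n y x)" for x y
  proof -
    have "Zqn_diff q n x y i = 0 \<longleftrightarrow> Zqn_diff q n y x i = 0" if "i \<in> {1..n}" for i
      using that by (auto simp: Zqn_diff_def mod_eq_0_iff_dvd dvd_diff_commute)
    then have "rt_dist q n x y \<le> m \<longleftrightarrow> rt_dist q n y x \<le> m" for m
      by (simp add: rt_dist_def rt_weight_le_iff)
    then have "rt_dist q n x y = rt_dist q n y x"
      by (meson antisym order_refl)
    then show ?thesis by simp
  qed
  show "real (rt_dist q n x y) = 0 \<longleftrightarrow> x = y" if "x \<in> Zqn q n" "y \<in> Zqn q n" for x y
    using rt_dist_le_iff[OF that, of 0] that by (auto simp: Zqn_def intro: PiE_ext)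
  show "real (rt_dist q n x z) \<le> real (rt_dist q n x y) + real (rt_dist q n y z)"
    if "x \<in> Zqn q n" "y \<in> Zqn q n" "z \<in> Zqn q n" for x y z
  proof -
    have "rt_dist q n x z \<le> rt_dist q n x y + rt_dist q n y z"
      using that rt_dist_le_iff[of x q n y "rt_dist q n x y"] rt_dist_le_iff[of y q n z "rt_dist q n y z"]
      by (subst rt_dist_le_iff) auto
    then show ?thesis by linarith
  qed
qed simp

end

theory Submission imports Defs begin

text \<open>
  Split a word of \<open>\<int>\<^sub>q\<^sup>n\<^sup>+\<^sup>m\<close> into its last \<open>m\<close> and its first \<open>n\<close> coordinates. Words with the same last
  \<open>m\<close> coordinates have the distance of their first parts, and all others are at distance greater than
  \<open>n\<close>. So passing from \<open>n\<close> to \<open>n + m\<close> without enlarging \<open>D\<close> produces \<open>q\<^sup>m\<close> disjoint copies,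
  and passing from \<open>n\<close> to \<open>n + 1\<close> while adding \<open>n + 1\<close> to \<open>D\<close> produces the join of \<open>q\<close> copies.
  The base graph \<open>K\<^sub>q(m)\<close> is the join of \<open>q\<close> copies of the edgeless graph on \<open>m\<close> vertices.
\<close>

definition rt_graph :: "nat \<Rightarrow> nat \<Rightarrow> nat set \<Rightarrow> (nat \<Rightarrow> int) ugraph" where
  "rt_graph q n D = distance_graph (Zqn q n) (\<lambda>x y. real (rt_dist q n x y)) (real ` D)"

text \<open>One-element lists are chosen so that prefixing a copy index yields exactly the vertices
  \<open>[i, a]\<close> of \<open>complete_multipartite\<close>, and the base case becomes an
  equality of graphs rather than an isomorphism.\<close>

definition edgeless_graph :: "nat \<Rightarrow> nat list ugraph" where
  "edgeless_graph m = \<lparr>verts = {[a] | a. a < m}, edges = {}\<rparr>"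

lemma rt_dist_commute: "rt_dist q n x y = rt_dist q n y x"
  using Metric_space.commute[OF Metric_space_rt_dist] by simp

lemma verts_rt_graph [simp]: "verts (rt_graph q n D) = Zqn q n"
  by (simp add: rt_graph_def distance_graph_def)

lemma edges_rt_graph_iff:
  assumes "x \<in> Zqn q n" "y \<in> Zqn q n"
  shows "{x, y} \<in> edges (rt_graph q n D) \<longleftrightarrow> x \<noteq> y \<and> rt_dist q n x y \<in> D"
  using assms rt_dist_commute[of q n x y]
  by (auto simp: rt_graph_def distance_graph_def doubleton_eq_iff)

lemma edges_copies_iff:
  "{i # u, j # v} \<in> edges (copies m G) \<longleftrightarrow> i = j \<and> i < m \<and> {u, v} \<in> edges G"
  by (auto simp: copies_def doubleton_eq_iff insert_commute)

lemma edges_join_copies_iff: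
  "{i # u, j # v} \<in> edges (join_copies m G) \<longleftrightarrow>
     i < m \<and> j < m \<and> (if i = j then {u, v} \<in> edges G else u \<in> verts G \<and> v \<in> verts G)"
  by (auto simp: join_copies_def edges_copies_iff doubleton_eq_iff)

lemma complete_multipartite_eq_join:
  "complete_multipartite r m = join_copies r (edgeless_graph m)"
  unfolding complete_multipartite_def join_copies_def copies_def edgeless_graph_def
  by simp blast

lemma restrict_in_Zqn: "x \<in> Zqn q (n + m) \<Longrightarrow> restrict x {1..n} \<in> Zqn q n"
  by (auto simp: Zqn_def PiE_iff)

lemma restrict_eq_iff_Zqn:
  assumes "x \<in> Zqn q (n + m)" "y \<in> Zqn q (n + m)" "\<forall>i\<in>{n<..n+m}. x i = y i"
  shows "restrict x {1..n} = restrict y {1..n} \<longleftrightarrow> x = y"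
proof
  assume "restrict x {1..n} = restrict y {1..n}"
  then have "\<forall>i\<in>{1..n}. x i = y i"
    by (metis restrict_apply')
  then have "x i = y i" if "i \<in> {1..n+m}" for i
    using that assms(3) by (cases "i \<le> n") auto
  with assms(1,2) show "x = y"
    unfolding Zqn_def by (intro PiE_ext)
qed simp

lemma card_Zqn: "card (Zqn q n) = q ^ n"
  by (simp add: Zqn_def card_PiE)

lemma finite_Zqn: "finite (Zqn q n)"
  by (simp add: Zqn_def finite_PiE)

text \<open>Any labelling \<open>f\<close> of short words extends to long words by prefixing a
  number that encodes the last \<open>m\<close> coordinates. Both graph constructions use the same
  vertex map, and all they need to know about \<open>top\<close> is its range and when two values
  agree.\<close>

lemma Zqn_split_bij:
  assumes f: "bij_betw f (Zqn q n) V"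
  obtains top :: "(nat \<Rightarrow> int) \<Rightarrow> nat" where
    "bij_betw (\<lambda>x. top x # f (restrict x {1..n})) (Zqn q (n + m)) {i # v | i v. i < q ^ m \<and> v \<in> V}"
    "\<And>x. x \<in> Zqn q (n + m) \<Longrightarrow> top x < q ^ m"
    "\<And>x y. x \<in> Zqn q (n + m) \<Longrightarrow> y \<in> Zqn q (n + m) \<Longrightarrow>
       top x = top y \<longleftrightarrow> (\<forall>i\<in>{n<..n+m}. x i = y i)"
proof -
  define T where "T = {n<..n+m} \<rightarrow>\<^sub>E {0..<int q}"
  have "finite T" "card T = card {..<q ^ m}"
    by (simp_all add: T_def card_PiE finite_PiE)
  then obtain e where e: "bij_betw e T {..<q ^ m}"
    using finite_same_card_bij by blast
  define top where "top x = e (restrict x {n<..n+m})" for x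
  have T: "restrict x {n<..n+m} \<in> T" if "x \<in> Zqn q (n + m)" for x
    using that by (auto simp: T_def Zqn_def PiE_iff)
  have less: "top x < q ^ m" if "x \<in> Zqn q (n + m)" for x
    using bij_betwE[OF e] T[OF that] by (auto simp: top_def)
  have eq: "top x = top y \<longleftrightarrow> (\<forall>i\<in>{n<..n+m}. x i = y i)"
    if "x \<in> Zqn q (n + m)" "y \<in> Zqn q (n + m)" for x y
  proof -
    have "top x = top y \<longleftrightarrow> restrict x {n<..n+m} = restrict y {n<..n+m}"
      unfolding top_def using bij_betw_imp_inj_on[OF e] T that by (auto dest: inj_onD)
    then show ?thesis
      by (metis restrict_apply' restrict_ext)
  qed
  have "inj_on (\<lambda>x. top x # f (restrict x {1..n})) (Zqn q (n + m))"
  proof (rule inj_onI)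
    fix x y assume xy: "x \<in> Zqn q (n + m)" "y \<in> Zqn q (n + m)"
      and "top x # f (restrict x {1..n}) = top y # f (restrict y {1..n})"
    then have hi: "\<forall>i\<in>{n<..n+m}. x i = y i"
      and "f (restrict x {1..n}) = f (restrict y {1..n})"
      using eq by auto
    then have "restrict x {1..n} = restrict y {1..n}"
      using bij_betw_imp_inj_on[OF f] xy restrict_in_Zqn by (auto dest: inj_onD)
    with hi xy show "x = y"
      using restrict_eq_iff_Zqn by blast
  qed
  moreover have "(\<lambda>x. top x # f (restrict x {1..n})) ` Zqn q (n + m)
      = {i # v | i v. i < q ^ m \<and> v \<in> V}" (is "?g ` _ = ?R")
  proof
    show "?g ` Zqn q (n + m) \<subseteq> ?R"
      using less bij_betwE[OF f] restrict_in_Zqn by blast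
    show "?R \<subseteq> ?g ` Zqn q (n + m)"
    proof
      fix w assume "w \<in> ?R"
      then obtain i v where w: "w = i # v" "i < q ^ m" "v \<in> V" by blast
      obtain t where t: "t \<in> T" "e t = i"
        using w bij_betw_imp_surj_on[OF e] by (metis imageE lessThan_iff)
      obtain b where b: "b \<in> Zqn q n" "f b = v"
        using w bij_betw_imp_surj_on[OF f] by (metis imageE)
      \<comment> \<open>Index \<open>0\<close> is sent to \<open>b\<close> and indices above
        \<open>n + m\<close> to \<open>t\<close>. Both are \<open>undefined\<close> there, so the
        glued function is extensional.\<close>
      define x where "x = (\<lambda>i. if i \<le> n then b i else t i)"
      have x: "x \<in> Zqn q (n + m)"
        using t b by (auto simp: x_def T_def Zqn_def PiE_iff extensional_def)
      have "restrict x {n<..n+m} = t"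
        using t by (auto simp: x_def T_def fun_eq_iff PiE_iff extensional_def)
      moreover have "restrict x {1..n} = b"
        using b by (auto simp: x_def Zqn_def fun_eq_iff PiE_iff extensional_def)
      ultimately have "?g x = w"
        using w t b by (simp add: top_def)
      with x show "w \<in> ?g ` Zqn q (n + m)" by blast
    qed
  qed
  ultimately show thesis
    using that less eq by (simp add: bij_betw_def)
qed

text \<open>Coordinates on which the words agree never obstruct an upper bound, so both distances
  have the same upper bounds \<open>k\<close> and are therefore equal.\<close>

lemma rt_dist_restrict:
  assumes "x \<in> Zqn q (n + m)" "y \<in> Zqn q (n + m)" "\<forall>i\<in>{n<..n+m}. x i = y i"
  shows "rt_dist q (n + m) x y = rt_dist q n (restrict x {1..n}) (restrict y {1..n})"
proof -
  have "rt_dist q (n + m) x y \<le> k \<longleftrightarrow>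
      rt_dist q n (restrict x {1..n}) (restrict y {1..n}) \<le> k" for k
    unfolding rt_dist_le_iff[OF assms(1,2)]
      rt_dist_le_iff[OF restrict_in_Zqn[OF assms(1)] restrict_in_Zqn[OF assms(2)]]
    using assms(3) by (auto simp: not_le)
  then show ?thesis by (meson antisym order_refl)
qed

lemma rt_dist_gt:
  assumes "x \<in> Zqn q (n + m)" "y \<in> Zqn q (n + m)" "\<not> (\<forall>i\<in>{n<..n+m}. x i = y i)"
  shows "n < rt_dist q (n + m) x y"
  using assms rt_dist_le_iff[OF assms(1,2), of n] by fastforce

lemma rt_dist_le: "x \<in> Zqn q n \<Longrightarrow> y \<in> Zqn q n \<Longrightarrow> rt_dist q n x y \<le> n"
  by (simp add: rt_dist_le_iff)

text \<open>The bound on \<open>D\<close> excludes every distance between words with different last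
  coordinates, so no edge joins two copies.\<close>

lemma rt_graph_iso_copies:
  assumes iso: "rt_graph q n D \<simeq>\<^sub>G H" and D: "\<forall>a\<in>D. a \<le> n"
  shows "rt_graph q (n + m) D \<simeq>\<^sub>G copies (q ^ m) H"
proof -
  obtain f where f: "bij_betw f (Zqn q n) (verts H)"
    and fe: "\<And>u v. u \<in> Zqn q n \<Longrightarrow> v \<in> Zqn q n \<Longrightarrow>
      {u, v} \<in> edges (rt_graph q n D) \<longleftrightarrow> {f u, f v} \<in> edges H"
    using iso unfolding graph_iso_def verts_rt_graph by blast
  obtain top where top:
    "bij_betw (\<lambda>x. top x # f (restrict x {1..n})) (Zqn q (n + m))
       {i # v | i v. i < q ^ m \<and> v \<in> verts H}"
    "\<And>x. x \<in> Zqn q (n + m) \<Longrightarrow> top x < q ^ m"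
    "\<And>x y. x \<in> Zqn q (n + m) \<Longrightarrow> y \<in> Zqn q (n + m) \<Longrightarrow>
       top x = top y \<longleftrightarrow> (\<forall>i\<in>{n<..n+m}. x i = y i)"
    using Zqn_split_bij[OF f, where m = m] by blast
  have "{x, y} \<in> edges (rt_graph q (n + m) D) \<longleftrightarrow>
      {top x # f (restrict x {1..n}), top y # f (restrict y {1..n})} \<in> edges (copies (q ^ m) H)"
    if xy: "x \<in> Zqn q (n + m)" "y \<in> Zqn q (n + m)" for x y
  proof (cases "top x = top y")
    case True
    then have hi: "\<forall>i\<in>{n<..n+m}. x i = y i" using top(3) xy by blast
    have r: "restrict x {1..n} \<in> Zqn q n" "restrict y {1..n} \<in> Zqn q n"
      using restrict_in_Zqn xy by blast+
    \<comment> \<open>Inside one copy, adjacency in \<open>H\<close> is pulled back along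
      \<open>f\<close> to short words, where the distance and the inequality of the words are the
      same as for \<open>x\<close> and \<open>y\<close>.\<close>
    show ?thesis
      unfolding edges_copies_iff fe[OF r, symmetric] edges_rt_graph_iff[OF r]
        edges_rt_graph_iff[OF xy] rt_dist_restrict[OF xy hi] restrict_eq_iff_Zqn[OF xy hi]
      using True top(2)[OF xy(2)] by simp
  next
    case False
    then have "n < rt_dist q (n + m) x y" using top(3) xy rt_dist_gt by blast
    with D False show ?thesis
      by (auto simp: edges_copies_iff edges_rt_graph_iff xy)
  qed
  with top(1) show ?thesis
    unfolding graph_iso_def by (auto simp: copies_def)
qed

lemma rt_graph_iso_join_copies:
  assumes iso: "rt_graph q n D \<simeq>\<^sub>G H" and D: "\<forall>a\<in>D. a \<le> n"
  shows "rt_graph q (Suc n) (insert (Suc n) D) \<simeq>\<^sub>G join_copies q H"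
proof -
  obtain f where f: "bij_betw f (Zqn q n) (verts H)"
    and fe: "\<And>u v. u \<in> Zqn q n \<Longrightarrow> v \<in> Zqn q n \<Longrightarrow>
      {u, v} \<in> edges (rt_graph q n D) \<longleftrightarrow> {f u, f v} \<in> edges H"
    using iso unfolding graph_iso_def verts_rt_graph by blast
  obtain top where top:
    "bij_betw (\<lambda>x. top x # f (restrict x {1..n})) (Zqn q (n + 1))
       {i # v | i v. i < q ^ 1 \<and> v \<in> verts H}"
    "\<And>x. x \<in> Zqn q (n + 1) \<Longrightarrow> top x < q ^ 1"
    "\<And>x y. x \<in> Zqn q (n + 1) \<Longrightarrow> y \<in> Zqn q (n + 1) \<Longrightarrow>
       top x = top y \<longleftrightarrow> (\<forall>i\<in>{n<..n+1}. x i = y i)"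
    using Zqn_split_bij[OF f, where m = 1] by blast
  have "{x, y} \<in> edges (rt_graph q (n + 1) (insert (Suc n) D)) \<longleftrightarrow>
      {top x # f (restrict x {1..n}), top y # f (restrict y {1..n})} \<in> edges (join_copies q H)"
    if xy: "x \<in> Zqn q (n + 1)" "y \<in> Zqn q (n + 1)" for x y
  proof (cases "top x = top y")
    case True
    then have hi: "\<forall>i\<in>{n<..n+1}. x i = y i" using top(3) xy by blast
    have r: "restrict x {1..n} \<in> Zqn q n" "restrict y {1..n} \<in> Zqn q n"
      using restrict_in_Zqn xy by blast+
    \<comment> \<open>Short words are at distance at most \<open>n\<close>, so the new element
      \<open>Suc n\<close> creates no edge inside a copy.\<close>
    show ?thesis
      unfolding edges_join_copies_iff fe[OF r, symmetric] edges_rt_graph_iff[OF r]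
        edges_rt_graph_iff[OF xy] rt_dist_restrict[OF xy hi] restrict_eq_iff_Zqn[OF xy hi]
      using True top(2)[OF xy(2)] rt_dist_le[OF r] by auto
  next
    case False
    then have "n < rt_dist q (n + 1) x y" using top(3) xy rt_dist_gt by blast
    then have "rt_dist q (n + 1) x y = Suc n"
      using rt_dist_le[OF xy] by simp
    moreover have "f (restrict x {1..n}) \<in> verts H" "f (restrict y {1..n}) \<in> verts H"
      using bij_betwE[OF f] restrict_in_Zqn xy by blast+
    ultimately show ?thesis
      unfolding edges_join_copies_iff edges_rt_graph_iff[OF xy]
      using False top(2)[OF xy(1)] top(2)[OF xy(2)] by auto
  qed
  with top(1) show ?thesis
    unfolding graph_iso_def by (auto simp: copies_def join_copies_def)
qed

text \<open>Neither side has edges, so any bijection between the vertex sets will do.\<close>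

lemma rt_graph_empty_iso: "rt_graph q n {} \<simeq>\<^sub>G edgeless_graph (q ^ n)"
proof -
  have V: "verts (edgeless_graph (q ^ n)) = (\<lambda>a. [a]) ` {..<q ^ n}"
    by (auto simp: edgeless_graph_def)
  then have "card (Zqn q n) = card (verts (edgeless_graph (q ^ n)))"
    by (simp add: card_Zqn card_image inj_on_def)
  then obtain f where "bij_betw f (Zqn q n) (verts (edgeless_graph (q ^ n)))"
    using finite_same_card_bij finite_Zqn V by (metis finite_imageI finite_lessThan)
  then show ?thesis
    unfolding graph_iso_def
    by (auto simp: edges_rt_graph_iff) (auto simp: edgeless_graph_def)
qed

lemma rt_graph_iso_H_graph:
  assumes "strict_mono_on {1..k} d" "1 \<le> d 1" "1 \<le> j" "j \<le> k"
  shows "rt_graph q (d j) (d ` {1..j}) \<simeq>\<^sub>G H_graph q d j"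
  using \<open>1 \<le> j\<close> \<open>j \<le> k\<close>
proof (induction j rule: nat_induct_at_least)
  case base
  have "rt_graph q (Suc (d 1 - 1)) {Suc (d 1 - 1)} \<simeq>\<^sub>G
      join_copies q (edgeless_graph (q ^ (d 1 - 1)))"
    using rt_graph_iso_join_copies[OF rt_graph_empty_iso] by blast
  with \<open>1 \<le> d 1\<close> show ?case
    by (simp add: complete_multipartite_eq_join)
next
  case (Suc j)
  \<comment> \<open>The recursive equation of \<open>H_graph\<close> only matches an index of the
    form \<open>Suc (Suc i)\<close>.\<close>
  then obtain i where i: "j = Suc i" by (cases j) auto
  have less: "d j < d (Suc j)"
    using strict_mono_onD[OF assms(1), of j "Suc j"] Suc by simp
  have le: "\<forall>a\<in>d ` {1..j}. a \<le> d j"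
    using strict_mono_on_leD[OF assms(1)] Suc by auto
  define m where "m = d (Suc j) - d j - 1"
  have m: "Suc (d j + m) = d (Suc j)" using less by (simp add: m_def)
  have "rt_graph q (d j + m) (d ` {1..j}) \<simeq>\<^sub>G copies (q ^ m) (H_graph q d j)"
    using rt_graph_iso_copies Suc le by simp
  then have "rt_graph q (d (Suc j)) (insert (d (Suc j)) (d ` {1..j})) \<simeq>\<^sub>G
      join_copies q (copies (q ^ m) (H_graph q d j))"
    using rt_graph_iso_join_copies le m by (metis trans_le_add1)
  moreover have "insert (d (Suc j)) (d ` {1..j}) = d ` {1..Suc j}"
    by (simp add: atLeastAtMostSuc_conv)
  ultimately show ?case
    by (simp add: i m_def)
qed

theorem theorem3p1:
  fixes q n k :: nat and d :: "nat \<Rightarrow> nat" and D :: "nat set"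
  assumes "q \<ge> 2" and "n \<ge> 1" and "k \<ge> 1"
    and "strict_mono_on {1..k} d" and "1 \<le> d 1" and "d k \<le> n"
    and "D = d ` {1..k}"
  shows "distance_graph (Zqn q n) (\<lambda>x y. real (rt_dist q n x y)) (real ` D)
           \<simeq>\<^sub>G copies (q ^ (n - d k)) (H_graph q d k)"
proof -
  have "\<forall>a\<in>D. a \<le> d k"
    using strict_mono_on_leD[OF assms(4)] assms(3,7) by auto
  moreover have "rt_graph q (d k) D \<simeq>\<^sub>G H_graph q d k"
    using rt_graph_iso_H_graph assms by simp
  \<comment> \<open>The \<open>n - d k\<close> coordinates beyond the largest distance contribute
    only disjoint copies.\<close>
  ultimately have "rt_graph q (d k + (n - d k)) D \<simeq>\<^sub>G copies (q ^ (n - d k)) (H_graph q d k)"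
    by (intro rt_graph_iso_copies)
  with \<open>d k \<le> n\<close> show ?thesis
    by (simp add: rt_graph_def)
qed

end
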